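(* Let $M$ be a smooth manifold diffeomorphic to $\mathbb{T}^d$ and let $\varphi_t:M\to M$ be a smooth flow which is $C^\infty$-conjugate to a rigid rotation: there is a $C^\infty$ diffeomorphism $\Phi:M\to\mathbb{T}^d$ with $\Phi(\varphi_t(x))=\Phi(x)+t\omega \pmod 1$ for all $t,x$, where $\omega\in\mathcal{D}_{c,\tau}$ for some $c>0$, $\tau\ge d-1$. Let $\mu$ be the $\varphi_t$-invariant probability measure on $M$ that is the pullback under $\Phi$ of Lebesgue (Haar) measure $d\theta$ on $\mathbb{T}^d$. (i) If $h\in C^\infty(M,\mathbb{R})$ and $g\in\mathcal{G}_\infty$, then for every $m\in\mathbb{N}$ there is a constant $c_m>0$, independent of $x$, such that \[ \left|W\!B_T(h)(x)-\int_M h\,d\mu\right|\le c_m T^{-m}\quad\text{for all } T>0 \text{ and all } x\in M . \] (ii) More generally, if $m\in\mathbb{N}$, $g\in\mathcal{G}_m$ and $h\in C^l(M,\mathbb{R})$ with $l>d+m\tau$, then there is a constant $c>0$ independent of $x$ and $T$ such that $\left|W\!B_T(h)(x)-\int_M h\,d\mu\right|\le c\,T^{-m}$ for all $T>0$ and $x\in M$.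
   Context: A vector $\omega\in\mathbb{R}^d$ is Diophantine, $\omega\in\mathcal{D}_{c,\tau}$ (with $c>0$, $\tau\ge d-1$), if $|k\cdot\omega|>c\|k\|^{-\tau}$ for all $k\in\mathbb{Z}^d\setminus\{0\}$. For $m\in\mathbb{N}\cup\{\infty\}$, $\mathcal{G}_m$ is the set of $g\in C^m([0,1],[0,\infty))$ with $\int_0^1g(s)\,ds=1$ and $g^{(i)}(0)=g^{(i)}(1)=0$ for $i=0,\dots,m-1$ (all $i\ge0$ when $m=\infty$). The weighted Birkhoff average is $W\!B_T(h)(x)=\frac1T\int_0^T g(t/T)\,h(\varphi_t(x))\,dt$. *)

theory Defs
  imports "HOL-Analysis.Analysis" "HOL-Library.Extended_Nat"
begin

fun Ck :: "nat \<Rightarrow> ('a::real_normed_vector \<Rightarrow> real) \<Rightarrow> bool" where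
  "Ck 0 f = continuous_on UNIV f"
| "Ck (Suc k) f = (\<exists>f'. (\<forall>x. (f has_derivative f' x) (at x)) \<and> (\<forall>v. Ck k (\<lambda>x. f' x v)))"

definition Cinf :: "('a::real_normed_vector \<Rightarrow> real) \<Rightarrow> bool" where
  "Cinf f \<longleftrightarrow> (\<forall>k. Ck k f)"

section \<open>The torus T^d = R^d / Z^d, represented by the fundamental domain [0,1)^d\<close>

definition torus_cube :: "(real^'n) set" where
  "torus_cube = {x. \<forall>i. 0 \<le> x$i \<and> x$i < 1}"

definition tmod :: "real^'n \<Rightarrow> real^'n" where
  "tmod y = (\<chi> i. frac (y$i))"

definition diophantine :: "real \<Rightarrow> real \<Rightarrow> real^'n \<Rightarrow> bool" where
  "diophantine c \<tau> \<omega> \<longleftrightarrow>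
     (\<forall>k::real^'n. (\<forall>i. k$i \<in> \<int>) \<and> k \<noteq> 0 \<longrightarrow> \<bar>k \<bullet> \<omega>\<bar> > c * norm k powr (-\<tau>))"

text \<open>The smooth structure of M is the one transported by Phi, so h is C^l on M iff
  its lift h o Phi^{-1} o (mod 1) is C^l on R^d.\<close>
definition lift_M :: "('m \<Rightarrow> real^'n) \<Rightarrow> ('m \<Rightarrow> real) \<Rightarrow> real^'n \<Rightarrow> real" where
  "lift_M \<Phi> h = (\<lambda>y. h (inv_into UNIV \<Phi> (tmod y)))"

definition pullback_haar :: "('m \<Rightarrow> real^'n) \<Rightarrow> 'm measure" where
  "pullback_haar \<Phi> =
     distr (lebesgue_on torus_cube) (vimage_algebra UNIV \<Phi> (lebesgue_on torus_cube))
           (inv_into UNIV \<Phi>)"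

definition weight_class :: "enat \<Rightarrow> (real \<Rightarrow> real) \<Rightarrow> bool" where
  "weight_class m g \<longleftrightarrow>
     (\<exists>D::nat \<Rightarrow> real \<Rightarrow> real.
        (\<forall>x\<in>{0..1}. D 0 x = g x) \<and>
        (\<forall>i. enat i < m \<longrightarrow> (\<forall>x\<in>{0..1}. (D i has_real_derivative D (Suc i) x) (at x within {0..1}))) \<and>
        (\<forall>i. enat i \<le> m \<longrightarrow> continuous_on {0..1} (D i)) \<and>
        (\<forall>i. enat i < m \<longrightarrow> D i 0 = 0 \<and> D i 1 = 0)) \<and>
     (\<forall>x\<in>{0..1}. 0 \<le> g x) \<and>
     integral {0..1} g = 1"

definition WB :: "(real \<Rightarrow> real) \<Rightarrow> (real \<Rightarrow> 'm \<Rightarrow> 'm) \<Rightarrow> ('m \<Rightarrow> real) \<Rightarrow> real \<Rightarrow> 'm \<Rightarrow> real" where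
  "WB g \<phi> h T x = (1 / T) * integral {0..T} (\<lambda>t. g (t / T) * h (\<phi> t x))"

end

theory Submission
  imports Defs
begin


text \<open>
  In the coordinate given by the conjugacy, the difference between the weighted average and the
  space average is a continuous function on the torus whose \<open>k\<close>-th Fourier coefficient is that of the
  lifted observable \<open>H\<close> times the Fourier transform of \<open>g\<close> at the frequency \<open>2 \<pi> T (k \<bullet> \<omega>)\<close>, and whose
  zeroth coefficient vanishes. Integrating by parts \<open>m\<close> times gains a factor \<open>(T \<bar>k \<bullet> \<omega>\<bar>)\<close> to the power
  \<open>-m\<close> from \<open>g\<close>, of which the Diophantine condition loses at most \<open>norm k\<close> to the power \<open>m \<tau>\<close>, while
  the regularity of \<open>H\<close> gains \<open>norm k\<close> to the power \<open>-l\<close>. For \<open>l > d + m \<tau>\<close> the result is summable.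

  No convergence of Fourier series is used: testing a continuous function against powers of a
  nonnegative trigonometric polynomial with a single peak shows that its sup norm is at most the
  supremum of the finite sums of the moduli of its Fourier coefficients.
\<close>

section \<open>Periodic functions and characters\<close>

text \<open>Periods and frequencies are kept as real vectors, so \<open>k \<bullet> \<omega>\<close>
  is an ordinary inner product and \<open>diophantine\<close> applies directly.\<close>

definition lattice :: "(real^'n) set" where
  "lattice = {k. \<forall>i. k$i \<in> \<int>}"

definition lattice_periodic :: "(real^'n \<Rightarrow> 'a) \<Rightarrow> bool" where
  "lattice_periodic f \<longleftrightarrow> (\<forall>k\<in>lattice. \<forall>x. f (x + k) = f x)"

definition character :: "real^'n \<Rightarrow> real^'n \<Rightarrow> complex" where
  "character k x = cis (2 * pi * (k \<bullet> x))"

definition fourier_coeff :: "(real^'n \<Rightarrow> complex) \<Rightarrow> real^'n \<Rightarrow> complex" where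
  "fourier_coeff f k = integral (cbox 0 1) (\<lambda>x. character (-k) x * f x)"

lemma lattice_axis: "axis i (of_int z) \<in> lattice"
  by (auto simp: lattice_def axis_def)

lemma lattice_zero: "0 \<in> lattice" and lattice_add: "k \<in> lattice \<Longrightarrow> k' \<in> lattice \<Longrightarrow> k + k' \<in> lattice"
  and lattice_uminus: "k \<in> lattice \<Longrightarrow> - k \<in> lattice"
  by (auto simp: lattice_def)

lemma lattice_diff: "k \<in> lattice \<Longrightarrow> k' \<in> lattice \<Longrightarrow> k - k' \<in> lattice"
  by (auto simp: lattice_def)

lemma lattice_inner: "k \<in> lattice \<Longrightarrow> k' \<in> lattice \<Longrightarrow> k \<bullet> k' \<in> \<int>"
  by (auto simp: lattice_def inner_vec_def)

section \<open>Translation invariance of the integral over a period cube\<close>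

lemma integral_cube_shift_axis_small:
  fixes f :: "real^'n \<Rightarrow> complex"
  assumes cont: "continuous_on UNIV f" and per: "lattice_periodic f" and t: "0 \<le> t" "t \<le> 1"
  shows "integral (cbox 0 1) (\<lambda>x. f (x + axis i t)) = integral (cbox 0 1) f"
proof -
  let ?b = "1 + axis i t"
  have int: "f integrable_on cbox a b" for a b
    by (rule integrable_continuous) (rule continuous_on_subset[OF cont], simp)
  have B: "(axis i 1 :: real^'n) \<in> Basis" by (simp add: axis_in_Basis_iff)
  have ax: "(axis i r :: real^'n) $ j = (if j = i then r else 0)" for r j
    by (simp add: axis_def)
  \<comment> \<open>Cutting the long box at height \<open>t\<close> leaves a slab and the shifted
    cube; cutting it at height 1 leaves the unit cube and a second slab. The slabs differ by the
    period \<open>axis i 1\<close>, so the two cubes carry the same integral.\<close>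
  have 1: "cbox 0 ?b \<inter> {x. x \<bullet> axis i 1 \<le> t} = cbox 0 (1 + axis i t - axis i 1)"
    unfolding set_eq_iff Int_iff mem_box_cart mem_Collect_eq inner_axis
    using t by (intro allI, simp add: ax, smt (verit))
  have 2: "cbox 0 ?b \<inter> {x. x \<bullet> axis i 1 \<ge> t} = cbox (axis i t) ?b"
    unfolding set_eq_iff Int_iff mem_box_cart mem_Collect_eq inner_axis
    using t by (intro allI, simp add: ax, smt (verit))
  have 3: "cbox 0 ?b \<inter> {x. x \<bullet> axis i 1 \<le> 1} = cbox 0 1"
    unfolding set_eq_iff Int_iff mem_box_cart mem_Collect_eq inner_axis
    using t by (intro allI, simp add: ax, smt (verit))
  have 4: "cbox 0 ?b \<inter> {x. x \<bullet> axis i 1 \<ge> 1} = cbox (axis i 1) ?b"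
    unfolding set_eq_iff Int_iff mem_box_cart mem_Collect_eq inner_axis
    using t by (intro allI, simp add: ax, smt (verit))
  have "integral (cbox 0 ?b) f = integral (cbox 0 (?b - axis i 1)) f + integral (cbox (axis i t) ?b) f"
    using integral_split[OF int B, of 0 ?b t] unfolding 1 2 by simp
  moreover have "integral (cbox 0 ?b) f = integral (cbox 0 1) f + integral (cbox (axis i 1) ?b) f"
    using integral_split[OF int B, of 0 ?b 1] unfolding 3 4 by simp
  moreover have "integral (cbox (axis i 1) ?b) f = integral (cbox 0 (?b - axis i 1)) f"
  proof -
    have "f (x + axis i 1) = f x" for x
      using per lattice_axis[of i 1] by (simp add: lattice_periodic_def)
    then show ?thesis
      using integral_shift_cbox[of "axis i 1" "axis i 1" ?b f] by simp
  qed
  moreover have "integral (cbox (axis i t) ?b) f = integral (cbox 0 1) (\<lambda>x. f (x + axis i t))"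
    using integral_shift_cbox[of "axis i t" "axis i t" ?b f] by simp
  ultimately show ?thesis by simp
qed

lemma integral_cube_shift_axis:
  fixes f :: "real^'n \<Rightarrow> complex"
  assumes cont: "continuous_on UNIV f" and per: "lattice_periodic f"
  shows "integral (cbox 0 1) (\<lambda>x. f (x + axis i t)) = integral (cbox 0 1) f"
proof -
  have "axis i t = axis i (frac t) + axis i (of_int \<lfloor>t\<rfloor>)"
    by (simp add: frac_def axis_def vec_eq_iff)
  then have "f (x + axis i t) = f (x + axis i (frac t))" for x
    using per lattice_axis[of i "\<lfloor>t\<rfloor>"] by (metis add.assoc lattice_periodic_def)
  then show ?thesis
    using integral_cube_shift_axis_small[OF assms frac_ge_0 less_imp_le[OF frac_lt_1]] by simp
qed

lemma lattice_periodic_shift: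
  "lattice_periodic f \<Longrightarrow> lattice_periodic (\<lambda>x. f (x + v))"
  by (simp add: lattice_periodic_def add.assoc add.commute[of v] flip: add.assoc)
    (metis add.assoc add.commute)

text \<open>A translation is a composition of axis translations, and each partial translate is again
  continuous and periodic.\<close>

lemma integral_cube_shift:
  fixes f :: "real^'n \<Rightarrow> complex"
  assumes cont: "continuous_on UNIV f" and per: "lattice_periodic f"
  shows "integral (cbox 0 1) (\<lambda>x. f (x + v)) = integral (cbox 0 1) f"
proof -
  have "integral (cbox 0 1) (\<lambda>x. f (x + (\<Sum>i\<in>S. axis i (v$i)))) = integral (cbox 0 1) f"
    if "finite S" for S
    using that
  proof (induction S rule: finite_induct)
    case empty
    then show ?case by simp
  next
    case (insert j S)
    let ?h = "\<lambda>x. f (x + (\<Sum>i\<in>S. axis i (v$i)))"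
    have "continuous_on UNIV ?h"
      by (rule continuous_on_compose2[OF cont]) (auto intro!: continuous_intros)
    from integral_cube_shift_axis[OF this lattice_periodic_shift[OF per], of j "v$j"]
    show ?case using insert by (simp add: algebra_simps)
  qed
  moreover have "(\<Sum>i\<in>UNIV. axis i (v$i)) = v"
    by (simp add: vec_eq_iff axis_def)
  ultimately show ?thesis
    by (metis finite_class.finite_UNIV)
qed

section \<open>Characters and their orthogonality\<close>

lemma continuous_on_character [continuous_intros]:
  "continuous_on S f \<Longrightarrow> continuous_on S (\<lambda>x. character k (f x))"
  unfolding character_def by (intro continuous_intros)

lemma norm_character [simp]: "norm (character k x) = 1"
  by (simp add: character_def)

lemma character_zero [simp]: "character 0 x = 1" "character k 0 = 1"
  by (simp_all add: character_def)

lemma character_add_left: "character (k + k') x = character k x * character k' x"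
  by (simp add: character_def inner_add_left distrib_left cis_mult)

lemma character_add_right: "character k (x + y) = character k x * character k y"
  by (simp add: character_def inner_add_right distrib_left cis_mult)

lemma lattice_periodic_character:
  assumes "k \<in> lattice" shows "lattice_periodic (character k)"
proof -
  have "character k l = 1" if l: "l \<in> lattice" for l
  proof -
    obtain n where "k \<bullet> l = of_int n" using lattice_inner[OF assms l] by (auto elim: Ints_cases)
    then show ?thesis by (simp add: character_def cis_multiple_2pi)
  qed
  then show ?thesis by (simp add: lattice_periodic_def character_add_right)
qed

lemma lattice_periodic_mult:
  "lattice_periodic f \<Longrightarrow> lattice_periodic g \<Longrightarrow> lattice_periodic (\<lambda>x. f x * g x)"
  by (simp add: lattice_periodic_def)

lemma content_unit_cube: "measure lborel (cbox 0 (1::real^'n)) = 1"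
  by (simp add: content_cbox_cart interval_ne_empty_cart)

text \<open>Translation by half a wavelength along a nonzero \<open>k\<close> negates the character
  but preserves the integral, which must then vanish.\<close>

lemma integral_character:
  assumes "k \<in> lattice"
  shows "integral (cbox 0 1) (character k) = (if k = 0 then 1 else 0)"
proof (cases "k = 0")
  case True
  then have "character k = (\<lambda>x. 1)" by auto
  then show ?thesis using True by (simp add: content_unit_cube)
next
  case False
  have "character k ((1 / (2 * (k \<bullet> k))) *\<^sub>R k) = -1"
    using False by (simp add: character_def cis_pi)
  then have "integral (cbox 0 1) (\<lambda>x. - character k x) = integral (cbox 0 1) (character k)"
    using integral_cube_shift[OF continuous_on_character lattice_periodic_character[OF assms], OF continuous_on_id, of "(1 / (2 * (k \<bullet> k))) *\<^sub>R k"]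
    by (simp add: character_add_right)
  then show ?thesis using False by simp
qed


section \<open>Decay of Fourier coefficients\<close>

text \<open>Along a segment of direction \<open>v\<close> the derivative integrates to
  \<open>f (x + v) - f x\<close>, whose mean over the torus is zero. Translation invariance and
  Fubini identify that mean with the mean of the derivative itself.\<close>

lemma integral_cube_derivative_eq_0:
  fixes f :: "real^'n \<Rightarrow> complex"
  assumes der: "\<And>x. (f has_derivative f' x) (at x)" and per: "lattice_periodic f"
    and cont: "continuous_on UNIV (\<lambda>x. f' x v)" and per': "lattice_periodic (\<lambda>x. f' x v)"
  shows "integral (cbox 0 1) (\<lambda>x. f' x v) = 0"
proof -
  have contf: "continuous_on UNIV f"
    using der by (auto simp: continuous_on_eq_continuous_at intro: has_derivative_continuous)
  have inner: "integral (cbox 0 (1::real)) (\<lambda>t. f' (x + t *\<^sub>R v) v) = f (x + v) - f x" for x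
  proof -
    have "((\<lambda>t. f (x + t *\<^sub>R v)) has_vector_derivative f' (x + t *\<^sub>R v) v) (at t within {0..1})" for t
    proof -
      have "((\<lambda>t. f (x + t *\<^sub>R v)) has_derivative (\<lambda>h. f' (x + t *\<^sub>R v) (h *\<^sub>R v))) (at t within {0..1})"
        by (rule has_derivative_compose[OF _ der]) (auto intro!: derivative_eq_intros)
      moreover have "f' (x + t *\<^sub>R v) (h *\<^sub>R v) = h *\<^sub>R f' (x + t *\<^sub>R v) v" for h
        using has_derivative_linear[OF der] by (simp add: linear_cmul)
      ultimately show ?thesis by (simp add: has_vector_derivative_def)
    qed
    then have "((\<lambda>t. f' (x + t *\<^sub>R v) v) has_integral f (x + 1 *\<^sub>R v) - f (x + 0 *\<^sub>R v)) {0..1}"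
      by (intro fundamental_theorem_of_calculus) auto
    then show ?thesis by (simp add: integral_unique)
  qed
  have shifted: "integral (cbox 0 1) (\<lambda>x. f' (x + t *\<^sub>R v) v) = integral (cbox 0 1) (\<lambda>x. f' x v)" for t
    using integral_cube_shift[OF cont per', of "t *\<^sub>R v"] .
  have int: "(\<lambda>x. f (x + w)) integrable_on cbox 0 1" for w
    by (intro integrable_continuous continuous_on_compose2[OF contf]) (auto intro!: continuous_intros)
  \<comment> \<open>By \<open>shifted\<close> the inner integral does not depend on
    \<open>t\<close>, so averaging it over the unit interval changes nothing.\<close>
  have "integral (cbox 0 1) (\<lambda>x. f' x v)
      = integral (cbox 0 (1::real)) (\<lambda>t. integral (cbox 0 1) (\<lambda>x. f' (x + t *\<^sub>R v) v))"
    unfolding shifted by simp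
  also have "\<dots> = integral (cbox 0 1) (\<lambda>x. integral (cbox 0 (1::real)) (\<lambda>t. f' (x + t *\<^sub>R v) v))"
    by (rule integral_swap_continuous[symmetric])
      (auto simp: split_beta intro!: continuous_intros continuous_on_compose2[OF cont])
  also have "\<dots> = integral (cbox 0 1) (\<lambda>x. f (x + v)) - integral (cbox 0 1) f"
    unfolding inner using int[of v] int[of 0] by (simp add: Henstock_Kurzweil_Integration.integral_diff)
  also have "\<dots> = 0"
    using integral_cube_shift[OF contf per] by simp
  finally show ?thesis .
qed

lemma has_derivative_character:
  "(character k has_derivative (\<lambda>h. \<i> * of_real (2 * pi * (k \<bullet> h)) * character k x)) (at x)"
proof -
  have "((\<lambda>x. \<i> * complex_of_real (2 * pi * (k \<bullet> x))) has_derivative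
      (\<lambda>h. \<i> * complex_of_real (2 * pi * (k \<bullet> h)))) (at x)"
    by (intro derivative_intros)
  from has_derivative_compose[OF this DERIV_exp[unfolded has_field_derivative_def]]
  show ?thesis
    by (simp add: character_def [abs_def] cis_conv_exp mult_ac)
qed

lemma lattice_periodic_derivative:
  assumes der: "\<And>x. (f has_derivative f' x) (at x)" and per: "lattice_periodic f"
  shows "lattice_periodic (\<lambda>x. f' x v)"
proof -
  have "f' (x + k) = f' x" if "k \<in> lattice" for x k
  proof -
    have "((\<lambda>y. f (y + k)) has_derivative (\<lambda>h. f' (x + k) h)) (at x)"
      by (rule has_derivative_compose[OF _ der]) (auto intro!: derivative_eq_intros)
    moreover have "(\<lambda>y. f (y + k)) = f"
      using per that by (auto simp: lattice_periodic_def)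
    ultimately show ?thesis
      using has_derivative_unique[OF der[of x]] by metis
  qed
  then show ?thesis by (simp add: lattice_periodic_def)
qed

lemma norm_fourier_coeff_le:
  fixes f :: "real^'n \<Rightarrow> complex"
  assumes "continuous_on UNIV f"
  shows "norm (fourier_coeff f k) \<le> integral (cbox 0 1) (\<lambda>x. norm (f x))"
  unfolding fourier_coeff_def
  by (rule integral_norm_bound_integral)
    (auto simp: norm_mult intro!: integrable_continuous continuous_intros continuous_on_subset[OF assms])

text \<open>Integration by parts on the torus: \<open>f\<close> times the conjugate character is
  periodic, so its derivative along \<open>v\<close> has mean zero, and the product rule splits that
  mean into the two sides.\<close>

lemma fourier_coeff_derivative:
  fixes f :: "real^'n \<Rightarrow> real"
  assumes der: "\<And>x. (f has_derivative f' x) (at x)" and per: "lattice_periodic f"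
    and cont: "continuous_on UNIV (\<lambda>x. f' x v)" and k: "k \<in> lattice"
  shows "fourier_coeff (\<lambda>x. of_real (f' x v)) k
      = \<i> * of_real (2 * pi * (k \<bullet> v)) * fourier_coeff (\<lambda>x. of_real (f x)) k"
proof -
  have contf: "continuous_on UNIV f"
    using der by (auto simp: continuous_on_eq_continuous_at intro: has_derivative_continuous)
  define F where "F = (\<lambda>x. character (-k) x * complex_of_real (f x))"
  define F' where "F' = (\<lambda>x h. character (-k) x * of_real (f' x h)
      + \<i> * of_real (2 * pi * ((-k) \<bullet> h)) * character (-k) x * complex_of_real (f x))"
  have der_F: "(F has_derivative F' x) (at x)" for x
    unfolding F_def F'_def
    by (rule has_derivative_mult[OF has_derivative_character has_derivative_of_real[OF der]])
  have per_F: "lattice_periodic F"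
    using per lattice_periodic_character[OF lattice_uminus[OF k]]
    unfolding F_def by (simp add: lattice_periodic_def)
  have cont_F': "continuous_on UNIV (\<lambda>x. F' x v)"
    unfolding F'_def by (intro continuous_intros cont contf)
  have "0 = integral (cbox 0 1) (\<lambda>x. F' x v)"
    using integral_cube_derivative_eq_0[OF der_F per_F cont_F' lattice_periodic_derivative[OF der_F per_F]] by simp
  also have "\<dots> = integral (cbox 0 1) (\<lambda>x. character (-k) x * of_real (f' x v)
       - \<i> * of_real (2 * pi * (k \<bullet> v)) * (character (-k) x * of_real (f x)))"
    by (simp add: F'_def mult.assoc)
  also have "\<dots> = fourier_coeff (\<lambda>x. of_real (f' x v)) k
      - \<i> * of_real (2 * pi * (k \<bullet> v)) * fourier_coeff (\<lambda>x. of_real (f x)) k"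
    unfolding fourier_coeff_def
    by (subst Henstock_Kurzweil_Integration.integral_diff)
      (auto intro!: integrable_continuous continuous_intros continuous_on_subset[OF cont] continuous_on_subset[OF contf])
  finally show ?thesis by simp
qed

lemma Ck_continuous_on: "Ck l f \<Longrightarrow> continuous_on UNIV f"
  by (cases l) (auto simp: continuous_on_eq_continuous_at intro: has_derivative_continuous)

text \<open>Each derivative along \<open>v\<close> multiplies the coefficient by a factor of modulus
  \<open>2 * pi * \<bar>k \<bullet> v\<bar>\<close>; after \<open>l\<close> of them the L1 norm
  bounds what is left.\<close>

lemma Ck_fourier_coeff_decay_direction:
  fixes f :: "real^'n \<Rightarrow> real"
  assumes "Ck l f" "lattice_periodic f"
  shows "\<exists>C. \<forall>k\<in>lattice. \<bar>k \<bullet> v\<bar> ^ l * norm (fourier_coeff (\<lambda>x. of_real (f x)) k) \<le> C"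
  using assms
proof (induction l arbitrary: f)
  case 0
  then have "continuous_on UNIV (\<lambda>x. complex_of_real (f x))"
    by (auto intro!: continuous_intros)
  from norm_fourier_coeff_le[OF this] show ?case by auto
next
  case (Suc l)
  from Suc.prems(1) obtain f' where der: "\<And>x. (f has_derivative f' x) (at x)"
    and "\<forall>v. Ck l (\<lambda>x. f' x v)"
    by auto
  then have Ck: "Ck l (\<lambda>x. f' x v)" by blast
  note cont = Ck_continuous_on[OF Ck]
  obtain C where C: "\<And>k. k \<in> lattice \<Longrightarrow>
      \<bar>k \<bullet> v\<bar> ^ l * norm (fourier_coeff (\<lambda>x. of_real (f' x v)) k) \<le> C"
    using Suc.IH[OF Ck lattice_periodic_derivative[OF der Suc.prems(2)]] by blast
  have "\<bar>k \<bullet> v\<bar> ^ Suc l * norm (fourier_coeff (\<lambda>x. of_real (f x)) k) \<le> C" if k: "k \<in> lattice" for k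
  proof -
    \<comment> \<open>The factor \<open>2 * pi\<close> exceeds 1 and is discarded, so the constant
      of the induction hypothesis is reused unchanged.\<close>
    have "1 * (\<bar>k \<bullet> v\<bar> * norm (fourier_coeff (\<lambda>x. of_real (f x)) k))
        \<le> 2 * pi * (\<bar>k \<bullet> v\<bar> * norm (fourier_coeff (\<lambda>x. of_real (f x)) k))"
      using pi_gt3 by (intro mult_right_mono) auto
    also have "\<dots> = norm (fourier_coeff (\<lambda>x. of_real (f' x v)) k)"
      by (simp add: fourier_coeff_derivative[OF der Suc.prems(2) cont k] norm_mult)
    finally have "\<bar>k \<bullet> v\<bar> ^ l * (\<bar>k \<bullet> v\<bar> * norm (fourier_coeff (\<lambda>x. of_real (f x)) k))
        \<le> \<bar>k \<bullet> v\<bar> ^ l * norm (fourier_coeff (\<lambda>x. of_real (f' x v)) k)"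
      by (intro mult_left_mono) auto
    with C[OF k] show ?thesis by (simp add: algebra_simps)
  qed
  then show ?case by blast
qed

lemma Ck_fourier_coeff_decay:
  fixes f :: "real^'n \<Rightarrow> real"
  assumes "Ck l f" "lattice_periodic f"
  shows "\<exists>C>0. \<forall>k\<in>lattice. norm k ^ l * norm (fourier_coeff (\<lambda>x. of_real (f x)) k) \<le> C"
proof -
  have "\<forall>i. \<exists>C. \<forall>k\<in>lattice. \<bar>k $ i\<bar> ^ l * norm (fourier_coeff (\<lambda>x. of_real (f x)) k) \<le> C"
    using Ck_fourier_coeff_decay_direction[OF assms, of "axis i 1" for i] by (simp add: inner_axis)
  then obtain C where C: "\<And>i k. k \<in> lattice \<Longrightarrow> \<bar>k $ i\<bar> ^ l * norm (fourier_coeff (\<lambda>x. of_real (f x)) k) \<le> C i"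
    by metis
  define d where "d = real CARD('n)"
  \<comment> \<open>Which coordinate of \<open>k\<close> is largest depends on \<open>k\<close>,
    hence the sum over all \<open>C i\<close>; the final 1 makes the constant positive.\<close>
  have "norm k ^ l * norm (fourier_coeff (\<lambda>x. of_real (f x)) k) \<le> d ^ l * (\<Sum>i\<in>UNIV. \<bar>C i\<bar>) + 1"
    if k: "k \<in> lattice" for k
  proof -
    obtain i where i: "\<And>j. \<bar>k $ j\<bar> \<le> \<bar>k $ i\<bar>"
      using Max_in[of "range (\<lambda>j. \<bar>k $ j\<bar>)"] Max_ge[of "range (\<lambda>j. \<bar>k $ j\<bar>)"]
      by (metis (no_types, lifting) UNIV_not_empty finite_class.finite_UNIV finite_imageI image_iff image_is_empty rangeI)
    have "norm k \<le> (\<Sum>j\<in>UNIV. \<bar>k $ j\<bar>)" by (rule norm_le_l1_cart)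
    also have "\<dots> \<le> d * \<bar>k $ i\<bar>"
      unfolding d_def using sum_mono[of UNIV "\<lambda>j. \<bar>k $ j\<bar>" "\<lambda>_. \<bar>k $ i\<bar>"] i by simp
    finally have "norm k ^ l \<le> d ^ l * \<bar>k $ i\<bar> ^ l"
      by (simp add: power_mono flip: power_mult_distrib)
    then have "norm k ^ l * norm (fourier_coeff (\<lambda>x. of_real (f x)) k)
        \<le> d ^ l * (\<bar>k $ i\<bar> ^ l * norm (fourier_coeff (\<lambda>x. of_real (f x)) k))"
      by (simp add: mult_right_mono flip: mult.assoc)
    also have "\<dots> \<le> d ^ l * C i"
      using C[OF k] by (intro mult_left_mono) (auto simp: d_def)
    also have "C i \<le> (\<Sum>i\<in>UNIV. \<bar>C i\<bar>)"
      using member_le_sum[of i UNIV "\<lambda>i. \<bar>C i\<bar>"] by simp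
    finally show ?thesis by (simp add: d_def mult_left_mono)
  qed
  moreover have "0 < d ^ l * (\<Sum>i\<in>UNIV. \<bar>C i\<bar>) + 1"
    by (intro add_nonneg_pos mult_nonneg_nonneg sum_nonneg) (auto simp: d_def)
  ultimately show ?thesis by blast
qed


section \<open>A sup-norm bound from the Fourier coefficients\<close>

text \<open>Laplace's method: away from \<open>h\<close> the values of \<open>q\<close> stay below
  \<open>M1\<close>, while on a small box around \<open>h\<close> they exceed a larger
  \<open>M2\<close>. Since \<open>(M1 / M2) ^ N\<close> tends to 0, the distant points become
  negligible against the total mass.\<close>

lemma integral_power_concentrates_at_peak:
  fixes q \<phi> :: "'a::euclidean_space \<Rightarrow> real"
  assumes h: "h \<in> box a b" and contq: "continuous_on (cbox a b) q" and cont\<phi>: "continuous_on (cbox a b) \<phi>"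
    and q0: "\<And>x. x \<in> cbox a b \<Longrightarrow> 0 \<le> q x" and qh: "0 < q h"
    and peak: "\<And>x. x \<in> cbox a b \<Longrightarrow> x \<noteq> h \<Longrightarrow> q x < q h"
    and \<phi>h: "\<phi> h = 0" and \<epsilon>: "0 < \<epsilon>"
  shows "\<exists>N. 0 < integral (cbox a b) (\<lambda>x. q x ^ N) \<and>
    integral (cbox a b) (\<lambda>x. \<phi> x * q x ^ N) \<le> \<epsilon> * integral (cbox a b) (\<lambda>x. q x ^ N)"
proof -
  have hc: "h \<in> cbox a b" using h box_subset_cbox by blast
  obtain \<delta> where \<delta>: "\<delta> > 0" "\<And>x. x \<in> cbox a b \<Longrightarrow> dist x h < \<delta> \<Longrightarrow> \<phi> x < \<epsilon> / 2"
  proof -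
    obtain \<delta> where "\<delta> > 0" "\<And>x. x \<in> cbox a b \<Longrightarrow> dist x h < \<delta> \<Longrightarrow> dist (\<phi> x) (\<phi> h) < \<epsilon> / 2"
      using cont\<phi> hc \<epsilon> unfolding continuous_on_iff by (meson half_gt_zero)
    then show ?thesis using that[of \<delta>] \<phi>h by (smt (verit) dist_real_def)
  qed
  \<comment> \<open>The maximum of \<open>q\<close> on the compact set outside the ball, or 0 if the
    ball covers the whole box.\<close>
  obtain M1 where M1: "0 \<le> M1" "M1 < q h" "\<And>x. x \<in> cbox a b \<Longrightarrow> \<not> dist x h < \<delta> \<Longrightarrow> q x \<le> M1"
  proof (cases "cbox a b - ball h \<delta> = {}")
    case True
    then have "dist x h < \<delta>" if "x \<in> cbox a b" for x using that by (auto simp: dist_commute)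
    then show ?thesis using that[of 0] qh by blast
  next
    case False
    have "compact (cbox a b - ball h \<delta>)" by (simp add: compact_diff)
    from continuous_attains_sup[OF this False continuous_on_subset[OF contq]]
    obtain z where z: "z \<in> cbox a b - ball h \<delta>" "\<And>x. x \<in> cbox a b - ball h \<delta> \<Longrightarrow> q x \<le> q z" by auto
    moreover have "z \<noteq> h" using z(1) \<delta>(1) by auto
    ultimately show ?thesis using that[of "q z"] q0 peak by (auto simp: dist_commute)
  qed
  \<comment> \<open>A level strictly between \<open>M1\<close> and the peak value; it is positive
    even if \<open>M1\<close> is 0, so it may be divided by.\<close>
  define M2 where "M2 = (M1 + q h) / 2"
  have M2: "0 < M2" "M1 < M2" "M2 < q h" using M1 by (auto simp: M2_def)
  have "open {x \<in> box a b. M2 < q x}"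
  proof -
    have "continuous_on (box a b) q" using contq box_subset_cbox continuous_on_subset by blast
    from continuous_open_preimage[OF this open_box open_greaterThan, of M2]
    show ?thesis by (simp add: vimage_def Int_def)
  qed
  moreover have "h \<in> {x \<in> box a b. M2 < q x}" using h M2 by simp
  ultimately obtain u v where uv: "h \<in> box u v" "cbox u v \<subseteq> {x \<in> box a b. M2 < q x}"
    by (rule open_contains_cbox)
  define w where "w = measure lborel (cbox u v)"
  have w: "0 < w"
    using uv(1) unfolding w_def content_pos_lt_eq by (auto simp: mem_box intro: less_trans)
  obtain K where K: "0 \<le> K" "\<And>x. x \<in> cbox a b \<Longrightarrow> \<phi> x \<le> K"
  proof -
    have "bounded (\<phi> ` cbox a b)"
      by (intro compact_imp_bounded compact_continuous_image cont\<phi> compact_cbox)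
    then show ?thesis using that by (auto simp: bounded_real dest!: spec) (smt (verit))
  qed
  define L where "L = K * measure lborel (cbox a b)"
  have L: "0 \<le> L" using K by (simp add: L_def)
  obtain N where N: "L * M1 ^ N \<le> \<epsilon> / 2 * w * M2 ^ N"
  proof -
    \<comment> \<open>The denominator \<open>L + 1\<close> covers the case
      \<open>L = 0\<close>.\<close>
    have "\<exists>N. (M1 / M2) ^ N < \<epsilon> / 2 * w / (L + 1)"
      using M1 M2 w \<epsilon> L by (intro real_arch_pow_inv) auto
    then obtain N where "(M1 / M2) ^ N < \<epsilon> / 2 * w / (L + 1)" ..
    then have "(L + 1) * M1 ^ N < \<epsilon> / 2 * w * M2 ^ N"
      using L M2 by (simp add: power_divide field_simps)
    moreover have "L * M1 ^ N \<le> (L + 1) * M1 ^ N" using M1 by (intro mult_right_mono) auto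
    ultimately show ?thesis by (intro that[of N]) linarith
  qed
  let ?I = "integral (cbox a b) (\<lambda>x. q x ^ N)"
  have iq: "(\<lambda>x. q x ^ N) integrable_on cbox a b"
    by (intro integrable_continuous continuous_intros contq)
  have "M2 ^ N * w = integral (cbox u v) (\<lambda>x. M2 ^ N)" by (simp add: w_def)
  also have "\<dots> \<le> integral (cbox u v) (\<lambda>x. q x ^ N)"
    using uv(2) M2 box_subset_cbox[of a b]
    by (intro integral_le integrable_continuous continuous_intros continuous_on_subset[OF contq] power_mono)
      (auto simp: subset_iff)
  also have "\<dots> \<le> ?I"
    using uv(2) box_subset_cbox[of a b] q0
    by (intro integral_subset_le integrable_continuous continuous_intros continuous_on_subset[OF contq] )
      (auto simp: subset_iff)
  finally have lower: "M2 ^ N * w \<le> ?I" .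
  have pos: "0 < ?I" using lower M2 w by (smt (verit) mult_pos_pos zero_less_power)
  \<comment> \<open>Near \<open>h\<close> the first summand dominates the integrand, elsewhere the
    second; both are nonnegative, so their sum is a bound everywhere.\<close>
  have "integral (cbox a b) (\<lambda>x. \<phi> x * q x ^ N)
      \<le> integral (cbox a b) (\<lambda>x. \<epsilon> / 2 * q x ^ N + K * M1 ^ N)"
  proof (rule integral_le)
    fix x assume x: "x \<in> cbox a b"
    show "\<phi> x * q x ^ N \<le> \<epsilon> / 2 * q x ^ N + K * M1 ^ N"
    proof (cases "dist x h < \<delta>")
      case True
      then have "\<phi> x * q x ^ N \<le> \<epsilon> / 2 * q x ^ N"
        using \<delta>(2)[OF x] q0[OF x] by (intro mult_right_mono) auto
      moreover have "0 \<le> K * M1 ^ N" using K M1 by simp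
      ultimately show ?thesis by linarith
    next
      case False
      have "\<phi> x * q x ^ N \<le> K * q x ^ N"
        using K q0[OF x] x by (intro mult_right_mono) auto
      also have "\<dots> \<le> K * M1 ^ N"
        using K q0[OF x] M1(3)[OF x False] by (intro mult_left_mono power_mono) auto
      finally have "\<phi> x * q x ^ N \<le> K * M1 ^ N" .
      moreover have "0 \<le> \<epsilon> / 2 * q x ^ N" using \<epsilon> q0[OF x] by simp
      ultimately show ?thesis by linarith
    qed
  qed (intro integrable_continuous continuous_intros contq cont\<phi>)+
  also have "\<dots> = \<epsilon> / 2 * ?I + L * M1 ^ N"
    using iq by (subst Henstock_Kurzweil_Integration.integral_add)
      (auto simp: L_def intro!: integrable_on_mult_right)
  also have "\<dots> \<le> \<epsilon> / 2 * ?I + \<epsilon> / 2 * (M2 ^ N * w)" using N by (simp add: mult_ac)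
  also have "\<dots> \<le> \<epsilon> / 2 * ?I + \<epsilon> / 2 * ?I" using lower \<epsilon> by (intro add_mono mult_left_mono) auto
  finally show ?thesis using pos by (intro exI[of _ N]) simp
qed

section \<open>Trigonometric polynomials as test functions\<close>

definition trig_poly :: "(real^'n \<Rightarrow> complex) \<Rightarrow> bool" where
  "trig_poly p \<longleftrightarrow> (\<exists>K c. finite K \<and> K \<subseteq> lattice \<and> (\<forall>x. p x = (\<Sum>k\<in>K. c k * character k x)))"

lemma trig_poly_zero: "trig_poly (\<lambda>x. 0)"
  unfolding trig_poly_def by (rule exI[of _ "{}"]) auto

lemma trig_poly_add:
  assumes "trig_poly p" "trig_poly q"
  shows "trig_poly (\<lambda>x. p x + q x)"
proof -
  obtain K c where K: "finite K" "K \<subseteq> lattice" "\<And>x. p x = (\<Sum>k\<in>K. c k * character k x)"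
    using assms(1) unfolding trig_poly_def by blast
  obtain L b where L: "finite L" "L \<subseteq> lattice" "\<And>x. q x = (\<Sum>k\<in>L. b k * character k x)"
    using assms(2) unfolding trig_poly_def by blast
  have "p x + q x = (\<Sum>k\<in>K \<union> L. ((if k \<in> K then c k else 0) + (if k \<in> L then b k else 0)) * character k x)" for x
  proof -
    have "p x = (\<Sum>k\<in>K \<union> L. (if k \<in> K then c k else 0) * character k x)"
      unfolding K(3) using K(1) L(1) by (intro sum.mono_neutral_cong_left) auto
    moreover have "q x = (\<Sum>k\<in>K \<union> L. (if k \<in> L then b k else 0) * character k x)"
      unfolding L(3) using K(1) L(1) by (intro sum.mono_neutral_cong_left) auto
    ultimately show ?thesis by (simp add: sum.distrib distrib_right)
  qed
  then show ?thesis
    unfolding trig_poly_def using K L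
    by (intro exI[of _ "K \<union> L"] exI[of _ "\<lambda>k. (if k \<in> K then c k else 0) + (if k \<in> L then b k else 0)"]) auto
qed

lemma trig_poly_mult_character:
  assumes "trig_poly p" "l \<in> lattice"
  shows "trig_poly (\<lambda>x. a * character l x * p x)"
proof -
  obtain K c where K: "finite K" "K \<subseteq> lattice" "\<And>x. p x = (\<Sum>k\<in>K. c k * character k x)"
    using assms(1) unfolding trig_poly_def by blast
  have "a * character l x * p x = (\<Sum>k\<in>(+) l ` K. (a * c (k - l)) * character k x)" for x
    by (subst sum.reindex) (auto simp: K(3) sum_distrib_left character_add_left mult_ac)
  then show ?thesis
    unfolding trig_poly_def using K assms(2)
    by (intro exI[of _ "(+) l ` K"] exI[of _ "\<lambda>k. a * c (k - l)"]) (auto intro: lattice_add)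
qed

lemma trig_poly_sum:
  "(\<And>i. i \<in> S \<Longrightarrow> trig_poly (p i)) \<Longrightarrow> trig_poly (\<lambda>x. \<Sum>i\<in>S. p i x)"
  by (induction S rule: infinite_finite_induct) (auto simp: trig_poly_zero trig_poly_add)

lemma trig_poly_one: "trig_poly (\<lambda>x. 1)"
  unfolding trig_poly_def by (rule exI[of _ "{0}"], rule exI[of _ "\<lambda>_. 1"]) (auto simp: lattice_zero)

text \<open>The normalised powers of this polynomial serve as the approximate identity, in place of a Fejer kernel.\<close>
definition peak_poly :: "real^'n \<Rightarrow> real" where
  "peak_poly x = (\<Sum>i\<in>UNIV. 1 - cos (2 * pi * x $ i))"

text \<open>A cosine is half the sum of two opposite characters, so multiplication by
  \<open>peak_poly\<close> only shifts frequencies by lattice vectors.\<close>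

lemma trig_poly_peak_poly_power: "trig_poly (\<lambda>x::real^'n. of_real (peak_poly x ^ N))"
proof (induction N)
  case 0
  then show ?case by (simp add: trig_poly_one)
next
  case (Suc N)
  let ?p = "\<lambda>x::real^'n. of_real (peak_poly x ^ N) :: complex"
  have cos: "complex_of_real (cos (2 * pi * x $ i))
      = 1/2 * character (axis i 1) x + 1/2 * character (- axis i 1) x" for x :: "real^'n" and i
    by (simp add: character_def inner_axis' complex_eq_iff)
  \<comment> \<open>The factor \<open>1 * character 0 x\<close> brings the constant term into the
    shape that \<open>trig_poly_mult_character\<close> expects.\<close>
  have eq: "of_real (peak_poly x ^ Suc N) = (\<Sum>i\<in>UNIV. 1 * character 0 x * ?p x
        + ((-1/2) * character (axis i 1) x * ?p x + (-1/2) * character (- axis i 1) x * ?p x))" for x :: "real^'n"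
  proof -
    have "of_real (peak_poly x ^ Suc N) = (\<Sum>i\<in>UNIV. 1 - complex_of_real (cos (2 * pi * x $ i))) * ?p x"
      by (simp add: peak_poly_def)
    then show ?thesis
      unfolding cos sum_distrib_right by (simp add: algebra_simps)
  qed
  have "axis i 1 \<in> lattice" "- axis i 1 \<in> lattice" for i :: 'n
    using lattice_axis[of i 1] by (auto intro: lattice_uminus)
  then show ?case
    unfolding eq by (intro trig_poly_sum trig_poly_add trig_poly_mult_character Suc lattice_zero)
qed

text \<open>Since \<open>p\<close> has finitely many frequencies, the integral is a finite pairing
  of coefficients of \<open>p\<close> and \<open>f\<close>. Those of \<open>p\<close> are at most
  its L1 norm, and \<open>B\<close> bounds the sum of the others.\<close>

lemma norm_integral_trig_poly_le:
  fixes f p :: "real^'n \<Rightarrow> complex"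
  assumes cont: "continuous_on UNIV f" and p: "trig_poly p"
    and B: "\<And>K. finite K \<Longrightarrow> K \<subseteq> lattice \<Longrightarrow> (\<Sum>k\<in>K. norm (fourier_coeff f k)) \<le> B"
  shows "norm (integral (cbox 0 1) (\<lambda>x. f x * p x)) \<le> B * integral (cbox 0 1) (\<lambda>x. norm (p x))"
proof -
  obtain K c where K: "finite K" "K \<subseteq> lattice" "\<And>x. p x = (\<Sum>k\<in>K. c k * character k x)"
    using p unfolding trig_poly_def by blast
  have contp: "continuous_on UNIV p"
    unfolding K(3) by (intro continuous_intros)
  \<comment> \<open>Orthogonality of characters recovers \<open>c k\<close> from \<open>p\<close>,
    which makes \<open>norm_fourier_coeff_le\<close> applicable to it.\<close>
  have coeff: "fourier_coeff p k = c k" if k: "k \<in> K" for k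
  proof -
    have "fourier_coeff p k = integral (cbox 0 1) (\<lambda>x. \<Sum>j\<in>K. c j * character (j - k) x)"
      unfolding fourier_coeff_def K(3)
      by (simp add: sum_distrib_left mult_ac diff_conv_add_uminus[of _ k] character_add_left del: add_uminus_conv_diff)
    also have "\<dots> = (\<Sum>j\<in>K. c j * integral (cbox 0 1) (character (j - k)))"
      using K(1) by (subst integral_sum) (auto intro!: integrable_continuous continuous_intros)
    also have "\<dots> = (\<Sum>j\<in>K. if j = k then c j else 0)"
      using K(2) k by (intro sum.cong) (auto simp: integral_character lattice_diff subset_iff)
    finally show ?thesis using K(1) k by simp
  qed
  have "integral (cbox 0 1) (\<lambda>x. f x * p x) = integral (cbox 0 1) (\<lambda>x. \<Sum>k\<in>K. c k * (character k x * f x))"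
    by (simp add: K(3) sum_distrib_left mult_ac)
  also have "\<dots> = (\<Sum>k\<in>K. c k * fourier_coeff f (-k))"
    using K(1) unfolding fourier_coeff_def
    by (subst integral_sum) (auto intro!: integrable_continuous continuous_intros continuous_on_subset[OF cont])
  also have "norm \<dots> \<le> (\<Sum>k\<in>K. norm (c k) * norm (fourier_coeff f (-k)))"
    by (rule order_trans[OF norm_sum]) (simp add: norm_mult)
  also have "\<dots> \<le> (\<Sum>k\<in>K. integral (cbox 0 1) (\<lambda>x. norm (p x)) * norm (fourier_coeff f (-k)))"
    using norm_fourier_coeff_le[OF contp] coeff by (intro sum_mono mult_right_mono) (metis, simp)
  \<comment> \<open>The pairing has no conjugation, so \<open>f\<close> is sampled at
    \<open>-k\<close>; reflecting the index set keeps it in the lattice, where \<open>B\<close>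
    applies.\<close>
  also have "\<dots> = integral (cbox 0 1) (\<lambda>x. norm (p x)) * (\<Sum>k\<in>uminus ` K. norm (fourier_coeff f k))"
    by (subst sum.reindex) (auto simp: sum_distrib_left)
  also have "\<dots> \<le> integral (cbox 0 1) (\<lambda>x. norm (p x)) * B"
    using K by (intro mult_left_mono B integral_nonneg integrable_continuous continuous_intros continuous_on_subset[OF contp])
      (auto intro: lattice_uminus)
  finally show ?thesis by (simp add: mult.commute)
qed

section \<open>Translation to the peak and the sup-norm bound\<close>

lemma fourier_coeff_shift:
  assumes cont: "continuous_on UNIV f" and per: "lattice_periodic f" and k: "k \<in> lattice"
  shows "fourier_coeff (\<lambda>x. f (x + v)) k = character k v * fourier_coeff f k"
proof -
  have ch: "character (-k) x = character k v * character (-k) (x + v)" for x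
  proof -
    have "character k v * character (-k) v = 1"
      by (simp flip: character_add_left)
    then show ?thesis by (simp add: character_add_right)
  qed
  have "fourier_coeff (\<lambda>x. f (x + v)) k
      = integral (cbox 0 1) (\<lambda>x. character k v * (character (-k) (x + v) * f (x + v)))"
    unfolding fourier_coeff_def by (subst ch) (simp add: mult.assoc)
  also have "\<dots> = character k v * integral (cbox 0 1) (\<lambda>x. character (-k) (x + v) * f (x + v))"
    by simp
  also have "\<dots> = character k v * fourier_coeff f k"
    unfolding fourier_coeff_def
    by (subst integral_cube_shift[where f = "\<lambda>x. character (-k) x * f x"])
      (auto intro!: continuous_intros cont lattice_periodic_mult lattice_periodic_character lattice_uminus per k)
  finally show ?thesis .
qed

lemma peak_poly_nonneg: "0 \<le> peak_poly x"
  by (simp add: peak_poly_def sum_nonneg)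

text \<open>A summand reaches its maximum 2 only where the cosine is -1, which in the unit interval
  forces the coordinate 1/2. The peak thus lies in the interior of the cube and is unique
  there.\<close>

lemma peak_poly_less_centre:
  fixes x :: "real^'n"
  assumes "x \<in> cbox 0 1" "x \<noteq> (\<chi> i. 1/2)"
  shows "peak_poly x < peak_poly ((\<chi> i. 1/2) :: real^'n)"
proof -
  obtain i where i: "x $ i \<noteq> 1/2" using assms(2) by (auto simp: vec_eq_iff)
  have "cos (2 * pi * x $ i) \<noteq> -1"
  proof
    assume "cos (2 * pi * x $ i) = -1"
    then obtain n :: int where "2 * pi * x $ i = (2 * real_of_int n + 1) * pi"
      unfolding cos_eq_minus1 by (auto simp: algebra_simps)
    then have n: "2 * x $ i = 2 * real_of_int n + 1" by simp
    with assms(1) have "0 \<le> 2 * real_of_int n + 1" "2 * real_of_int n + 1 \<le> 2"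
      unfolding mem_box_cart by (metis mult_nonneg_nonneg zero_index zero_le_numeral, metis mult_left_mono mult.right_neutral one_index zero_le_numeral)
    then have "n = 0" by linarith
    with n i show False by simp
  qed
  then have "1 - cos (2 * pi * x $ i) < 2"
    using cos_ge_minus_one[of "2 * pi * x $ i"] by linarith
  moreover have "1 - cos (2 * pi * x $ j) \<le> 2" for j
    using cos_ge_minus_one[of "2 * pi * x $ j"] by linarith
  ultimately have "peak_poly x < (\<Sum>i\<in>(UNIV::'n set). 2)"
    unfolding peak_poly_def by (intro sum_strict_mono_ex1) auto
  then show ?thesis by (simp add: peak_poly_def)
qed

text \<open>Translating \<open>y\<close> to the peak changes the coefficients by phases only. A high
  power of \<open>peak_poly\<close> then nearly evaluates the function at the peak, while its
  integral against the function is at most \<open>B\<close> times its mass.\<close>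

lemma norm_le_of_fourier_coeff_sums_le:
  fixes f :: "real^'n \<Rightarrow> complex"
  assumes cont: "continuous_on UNIV f" and per: "lattice_periodic f"
    and B: "\<And>K. finite K \<Longrightarrow> K \<subseteq> lattice \<Longrightarrow> (\<Sum>k\<in>K. norm (fourier_coeff f k)) \<le> B"
  shows "norm (f y) \<le> B"
proof (rule ccontr)
  assume "\<not> norm (f y) \<le> B"
  define h :: "real^'n" where "h = (\<chi> i. 1/2)"
  define F where "F = (\<lambda>x. f (x + (y - h)))"
  \<comment> \<open>Half the supposed excess over \<open>B\<close>, so that
    \<open>norm (F h) \<le> B + \<epsilon>\<close> is already contradictory.\<close>
  define \<epsilon> where "\<epsilon> = (norm (f y) - B) / 2"
  have \<epsilon>: "0 < \<epsilon>" using \<open>\<not> norm (f y) \<le> B\<close> by (simp add: \<epsilon>_def)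
  have Fh: "F h = f y" by (simp add: F_def)
  have contF: "continuous_on UNIV F"
    unfolding F_def by (rule continuous_on_compose2[OF cont]) (auto intro!: continuous_intros)
  have BF: "(\<Sum>k\<in>K. norm (fourier_coeff F k)) \<le> B" if "finite K" "K \<subseteq> lattice" for K
  proof -
    have "(\<Sum>k\<in>K. norm (fourier_coeff F k)) = (\<Sum>k\<in>K. norm (fourier_coeff f k))"
      using that unfolding F_def
      by (intro sum.cong) (auto simp: fourier_coeff_shift[OF cont per] norm_mult subset_iff)
    then show ?thesis using B[OF that] by simp
  qed
  have contq: "continuous_on S peak_poly" for S :: "(real^'n) set"
    unfolding peak_poly_def by (intro continuous_intros)
  have "\<exists>N. 0 < integral (cbox 0 1) (\<lambda>x::real^'n. peak_poly x ^ N) \<and>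
    integral (cbox 0 1) (\<lambda>x. norm (F h - F x) * peak_poly x ^ N) \<le> \<epsilon> * integral (cbox 0 (1::real^'n)) (\<lambda>x. peak_poly x ^ N)"
  proof (rule integral_power_concentrates_at_peak[where h = h])
    show "h \<in> box 0 1" by (simp add: h_def mem_box_cart)
    show "0 < peak_poly h" by (simp add: h_def peak_poly_def)
  qed (use \<epsilon> in \<open>auto simp: peak_poly_nonneg h_def intro!: contq continuous_intros continuous_on_subset[OF contF] peak_poly_less_centre\<close>)
  then obtain N where pos: "0 < integral (cbox 0 1) (\<lambda>x::real^'n. peak_poly x ^ N)"
    and N: "integral (cbox 0 1) (\<lambda>x. norm (F h - F x) * peak_poly x ^ N)
      \<le> \<epsilon> * integral (cbox 0 1) (\<lambda>x::real^'n. peak_poly x ^ N)"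
    by blast
  let ?I = "integral (cbox 0 1) (\<lambda>x::real^'n. peak_poly x ^ N)"
  let ?p = "\<lambda>x::real^'n. complex_of_real (peak_poly x ^ N)"
  have int: "(\<lambda>x. G x * ?p x) integrable_on cbox 0 1" if "continuous_on UNIV G" for G
    using that by (intro integrable_continuous continuous_intros contq) (auto intro: continuous_on_subset)
  have intp: "(?p has_integral of_real ?I) (cbox 0 1)"
    by (intro has_integral_of_real integrable_integral integrable_continuous continuous_intros contq)
  have "norm (F h) * ?I = norm (F h * of_real ?I)" using pos by (simp add: norm_mult)
  also have "F h * of_real ?I = integral (cbox 0 1) (\<lambda>x. F h * ?p x)"
    by (rule integral_unique[symmetric]) (rule has_integral_mult_right[OF intp])
  \<comment> \<open>The first part is estimated through Fourier coefficients, the second by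
    concentration, as \<open>F h - F x\<close> vanishes at the peak.\<close>
  also have "\<dots> = integral (cbox 0 1) (\<lambda>x. F x * ?p x + (F h - F x) * ?p x)"
    by (simp add: algebra_simps)
  also have "\<dots> = integral (cbox 0 1) (\<lambda>x. F x * ?p x) + integral (cbox 0 1) (\<lambda>x. (F h - F x) * ?p x)"
    by (intro Henstock_Kurzweil_Integration.integral_add int continuous_intros contF)
  also have "norm \<dots> \<le> B * integral (cbox 0 1) (\<lambda>x. norm (?p x)) + integral (cbox 0 1) (\<lambda>x. norm (F h - F x) * peak_poly x ^ N)"
    by (intro norm_triangle_mono norm_integral_trig_poly_le contF BF trig_poly_peak_poly_power
        integral_norm_bound_integral int continuous_intros integrable_continuous contq
        continuous_on_subset[OF contF])
      (auto simp: norm_mult norm_power peak_poly_nonneg)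
  also have "\<dots> \<le> B * ?I + \<epsilon> * ?I"
    using N by (simp add: norm_power peak_poly_nonneg)
  finally have "norm (F h) \<le> B + \<epsilon>" using pos by (simp flip: distrib_right)
  with Fh \<epsilon> show False by (simp add: \<epsilon>_def field_simps)
qed


section \<open>Decay of the weight and summation over the lattice\<close>

lemma weight_class_continuous_on:
  assumes "weight_class m g" shows "continuous_on {0..1} g"
proof -
  obtain D where "\<forall>x\<in>{0..1}. D 0 x = g x" "\<forall>i. enat i \<le> m \<longrightarrow> continuous_on {0..1} (D i)"
    using assms unfolding weight_class_def by blast
  then show ?thesis
    by (metis continuous_on_cong zero_enat_def zero_le)
qed

text \<open>Below order \<open>m\<close> the boundary terms vanish because \<open>D i\<close> is
  zero at both endpoints, so each integration by parts gains a factor \<open>\<bar>r\<bar>\<close>.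
  The last function \<open>D m\<close> enters only through its L1 norm.\<close>

lemma weight_class_fourier_decay:
  assumes "weight_class (enat m) g"
  shows "\<exists>C>0. \<forall>r. \<bar>r\<bar> ^ m * norm (integral {0..1} (\<lambda>s. of_real (g s) * cis (r * s))) \<le> C"
proof -
  obtain D where D0: "\<And>x. x \<in> {0..1} \<Longrightarrow> D 0 x = g x"
    and der: "\<And>i x. i < m \<Longrightarrow> x \<in> {0..1} \<Longrightarrow> (D i has_real_derivative D (Suc i) x) (at x within {0..1})"
    and cont: "\<And>i. i \<le> m \<Longrightarrow> continuous_on {0..1} (D i)"
    and bd: "\<And>i. i < m \<Longrightarrow> D i 0 = 0 \<and> D i 1 = 0"
    using assms unfolding weight_class_def by (metis enat_ord_simps(1) enat_ord_simps(2))
  define J where "J = (\<lambda>i r. integral {0..1} (\<lambda>s. of_real (D i s) * cis (r * s)))"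
  have int: "(\<lambda>s. complex_of_real (D i s) * cis (r * s)) integrable_on {0..1}" if "i \<le> m" for i r
    using cont[OF that] by (intro integrable_continuous_interval continuous_intros)
  have step: "J (Suc i) r = - (\<i> * of_real r) * J i r" if i: "i < m" for i r
  proof -
    have "((\<lambda>s. complex_of_real (D i s) * cis (r * s)) has_vector_derivative
        (of_real (D (Suc i) s) * cis (r * s) + (\<i> * of_real r) * (of_real (D i s) * cis (r * s)))) (at s within {0..1})"
      if "s \<in> {0..1}" for s
    proof -
      have 1: "((\<lambda>s. complex_of_real (D i s)) has_vector_derivative of_real (D (Suc i) s)) (at s within {0..1})"
        using der[OF i that] by (intro has_vector_derivative_of_real)
          (simp add: has_real_derivative_iff_has_vector_derivative)
      have 2: "((\<lambda>s. cis (r * s)) has_vector_derivative \<i> * of_real r * cis (r * s)) (at s within {0..1})"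
      proof -
        have "((\<lambda>z. exp (\<i> * (of_real r * z))) has_field_derivative \<i> * of_real r * exp (\<i> * (of_real r * of_real s)))
            (at (of_real s))"
          by (auto intro!: derivative_eq_intros)
        from has_vector_derivative_real_field[OF this] show ?thesis by (simp add: cis_conv_exp)
      qed
      from has_vector_derivative_mult[OF 1 2] show ?thesis by (simp add: algebra_simps)
    qed
    then have "((\<lambda>s. of_real (D (Suc i) s) * cis (r * s) + (\<i> * of_real r) * (of_real (D i s) * cis (r * s)))
        has_integral complex_of_real (D i 1) * cis (r * 1) - of_real (D i 0) * cis (r * 0)) {0..1}"
      by (intro fundamental_theorem_of_calculus) auto
    then have "integral {0..1} (\<lambda>s. of_real (D (Suc i) s) * cis (r * s) + (\<i> * of_real r) * (of_real (D i s) * cis (r * s))) = 0"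
      using bd[OF i] by (simp add: integral_unique)
    then have "J (Suc i) r + \<i> * of_real r * J i r = 0"
      unfolding J_def using int[of "Suc i" r] int[of i r] i
      by (subst (asm) Henstock_Kurzweil_Integration.integral_add) (auto intro: integrable_on_mult_right)
    then show ?thesis by (simp add: eq_neg_iff_add_eq_0)
  qed
  have iter: "norm (J i r) = \<bar>r\<bar> ^ i * norm (J 0 r)" if "i \<le> m" for i r
    using that by (induction i) (auto simp: step norm_mult)
  have "\<bar>r\<bar> ^ m * norm (integral {0..1} (\<lambda>s. of_real (g s) * cis (r * s))) \<le> integral {0..1} (\<lambda>s. \<bar>D m s\<bar>) + 1" for r
  proof -
    have "integral {0..1} (\<lambda>s. of_real (g s) * cis (r * s)) = J 0 r"
      unfolding J_def using D0 by (intro integral_cong) auto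
    moreover have "norm (J m r) \<le> integral {0..1} (\<lambda>s. \<bar>D m s\<bar>)"
      unfolding J_def using cont[of m]
      by (intro integral_norm_bound_integral integrable_continuous_interval continuous_intros) (auto simp: norm_mult)
    ultimately show ?thesis using iter[of m r] by simp
  qed
  moreover have "0 < integral {0..1} (\<lambda>s. \<bar>D m s\<bar>) + 1"
    using cont[of m] by (intro add_nonneg_pos Henstock_Kurzweil_Integration.integral_nonneg integrable_continuous_interval continuous_intros) auto
  ultimately show ?thesis by blast
qed

section \<open>Summability of negative powers over the lattice\<close>

text \<open>The maximum with 1 gives \<open>j = 0\<close> the weight 1. As
  \<open>0 powr (-p)\<close> is 0, omitting it would spoil the later product bound for lattice
  vectors with a zero coordinate.\<close>

lemma sum_int_powr_bounded:
  fixes p :: real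
  assumes p: "1 < p"
  shows "\<exists>Z. \<forall>J::int set. finite J \<longrightarrow> (\<Sum>j\<in>J. max 1 \<bar>of_int j\<bar> powr (-p)) \<le> Z"
proof -
  have sm: "summable (\<lambda>n. real n powr (-p))"
    using p by (simp add: summable_real_powr_iff)
  define Z where "Z = (\<Sum>n. real n powr (-p))"
  let ?a = "\<lambda>j::int. max 1 \<bar>real_of_int j\<bar> powr (-p)"
  have pos: "sum ?a J \<le> Z" if "finite J" "\<And>j. j \<in> J \<Longrightarrow> 0 < j" for J
  proof -
    have "sum ?a J = (\<Sum>n\<in>nat ` J. real n powr (-p))"
    proof (subst sum.reindex)
      show "inj_on nat J" using that(2) by (auto simp: inj_on_def dest!: that(2))
      show "sum ?a J = sum ((\<lambda>n. real n powr (-p)) \<circ> nat) J"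
        using that(2) by (intro sum.cong refl) (fastforce simp: max_def)
    qed
    also have "\<dots> \<le> Z"
      unfolding Z_def using that(1) by (intro sum_le_suminf sm) auto
    finally show ?thesis .
  qed
  have "sum ?a J \<le> 2 * Z + 1" if J: "finite J" for J
  proof -
    have neg: "sum ?a {j \<in> J. j < 0} = sum ?a (uminus ` {j \<in> J. j < 0})"
      by (subst sum.reindex) auto
    \<comment> \<open>The point 0 is adjoined whether or not it lies in \<open>J\<close>; it
      contributes exactly 1.\<close>
    have "sum ?a J \<le> sum ?a ({j \<in> J. 0 < j} \<union> ({j \<in> J. j < 0} \<union> {0}))"
      using J by (intro sum_mono2) auto
    also have "\<dots> = sum ?a {j \<in> J. 0 < j} + (sum ?a {j \<in> J. j < 0} + sum ?a {0})"
      using J by (subst sum.union_disjoint, auto)+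
    also have "\<dots> \<le> Z + (Z + 1)"
      unfolding neg using J by (intro add_mono pos) auto
    finally show ?thesis by simp
  qed
  then show ?thesis by blast
qed

lemma lattice_norm_ge_1:
  assumes "k \<in> lattice" "k \<noteq> 0"
  shows "1 \<le> norm k"
proof -
  obtain i where i: "k $ i \<noteq> 0" using assms(2) by (auto simp: vec_eq_iff)
  then have "1 \<le> \<bar>k $ i\<bar>" using assms(1) by (intro Ints_nonzero_abs_ge1) (auto simp: lattice_def)
  also have "\<dots> \<le> norm k" by (rule component_le_norm_cart)
  finally show ?thesis .
qed

text \<open>The exponent is shared equally among the coordinates. A nonzero lattice vector has norm
  at least 1 and at least each \<open>\<bar>k $ i\<bar>\<close>, so its summand is at most a product
  of one-dimensional weights, summable because \<open>p > 1\<close>.\<close>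

lemma sum_lattice_powr_bounded:
  fixes s :: real
  assumes s: "real CARD('n) < s"
  shows "\<exists>S. \<forall>K::(real^'n) set. finite K \<longrightarrow> K \<subseteq> lattice - {0} \<longrightarrow> (\<Sum>k\<in>K. norm k powr (-s)) \<le> S"
proof -
  define p where "p = s / real CARD('n)"
  have p: "1 < p" using s by (simp add: p_def)
  let ?a = "\<lambda>j::int. max 1 \<bar>real_of_int j\<bar> powr (-p)"
  obtain Z where Z: "\<And>J. finite J \<Longrightarrow> sum ?a J \<le> Z"
    using sum_int_powr_bounded[OF p] by blast
  have "(\<Sum>k\<in>K. norm k powr (-s)) \<le> Z ^ CARD('n)"
    if K: "finite K" "K \<subseteq> lattice - {0}" for K :: "(real^'n) set"
  proof -
    define \<kappa> where "\<kappa> = (\<lambda>(k::real^'n) i. \<lfloor>k $ i\<rfloor>)"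
    have \<kappa>: "real_of_int (\<kappa> k i) = k $ i" if "k \<in> K" for k i
    proof -
      have "k $ i \<in> \<int>" using that K(2) by (auto simp: lattice_def)
      then show ?thesis by (auto simp: \<kappa>_def elim: Ints_cases)
    qed
    have inj: "inj_on \<kappa> K"
      by (intro inj_onI) (metis \<kappa> vec_eq_iff)
    \<comment> \<open>One finite set containing all coordinates that occur: on the full grid over
      \<open>J\<close> the sum of products factors into a product of sums.\<close>
    define J where "J = (\<lambda>(k, i). \<kappa> k i) ` (K \<times> UNIV)"
    have J: "finite J" using K(1) by (simp add: J_def)
    have "norm k powr (-s) \<le> (\<Prod>i\<in>UNIV. ?a (\<kappa> k i))" if k: "k \<in> K" for k
    proof -
      have 1: "1 \<le> norm k" using lattice_norm_ge_1 k K(2) by blast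
      have "norm k powr (-s) = (\<Prod>i\<in>(UNIV::'n set). norm k powr (-p))"
        using 1 powr_realpow[of "norm k powr (-p)" "CARD('n)"] by (cases "k = 0") (auto simp: p_def powr_powr)
      also have "\<dots> \<le> (\<Prod>i\<in>UNIV. ?a (\<kappa> k i))"
        using 1 p component_le_norm_cart[of k] \<kappa>[OF k]
        by (intro prod_mono conjI powr_mono2') auto
      finally show ?thesis .
    qed
    then have "(\<Sum>k\<in>K. norm k powr (-s)) \<le> (\<Sum>k\<in>K. \<Prod>i\<in>UNIV. ?a (\<kappa> k i))"
      by (rule sum_mono)
    also have "\<dots> = (\<Sum>f\<in>\<kappa> ` K. \<Prod>i\<in>UNIV. ?a (f i))"
      by (simp add: sum.reindex[OF inj])
    also have "\<dots> \<le> (\<Sum>f\<in>(\<Pi>\<^sub>E i\<in>(UNIV::'n set). J). \<Prod>i\<in>UNIV. ?a (f i))"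
    proof (rule sum_mono2)
      show "finite (\<Pi>\<^sub>E i\<in>(UNIV::'n set). J)" using J by (intro finite_PiE) auto
      show "\<kappa> ` K \<subseteq> (\<Pi>\<^sub>E i\<in>UNIV. J)" by (auto simp: J_def)
    qed (auto intro: prod_nonneg)
    also have "\<dots> = (\<Prod>i\<in>(UNIV::'n set). sum ?a J)"
      using J by (subst prod_sum_PiE) auto
    also have "\<dots> \<le> (\<Prod>i\<in>(UNIV::'n set). Z)"
      using Z[OF J] by (intro prod_mono) (auto intro: sum_nonneg)
    finally show ?thesis by simp
  qed
  then show ?thesis by blast
qed


section \<open>Weighted averages along a Diophantine rotation\<close>

lemma integral_of_real_integrable:
  assumes "f integrable_on S"
  shows "integral S (\<lambda>x. complex_of_real (f x)) = of_real (integral S f)"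
  by (intro integral_unique has_integral_of_real integrable_integral assms)

text \<open>After Fubini, each translate of \<open>H\<close> contributes only a phase, and the
  phases gather into the Fourier transform of \<open>g\<close>.\<close>

lemma fourier_coeff_weighted_average:
  fixes H :: "real^'n \<Rightarrow> complex"
  assumes cont: "continuous_on UNIV H" and per: "lattice_periodic H"
    and g: "continuous_on {0..1} g" and k: "k \<in> lattice"
  shows "fourier_coeff (\<lambda>y. integral {0..1} (\<lambda>s. of_real (g s) * H (y + s *\<^sub>R v))) k
    = integral {0..1} (\<lambda>s. of_real (g s) * cis (2 * pi * (k \<bullet> v) * s)) * fourier_coeff H k"
proof -
  have "fourier_coeff (\<lambda>y. integral {0..1} (\<lambda>s. of_real (g s) * H (y + s *\<^sub>R v))) k
      = integral (cbox 0 1) (\<lambda>y. integral (cbox 0 1) (\<lambda>s. of_real (g s) * (character (-k) y * H (y + s *\<^sub>R v))))"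
    unfolding fourier_coeff_def by (simp add: mult.left_commute flip: integral_mult_right)
  also have "\<dots> = integral (cbox 0 1) (\<lambda>s. integral (cbox 0 1) (\<lambda>y. of_real (g s) * (character (-k) y * H (y + s *\<^sub>R v))))"
  proof (rule integral_swap_continuous)
    have "continuous_on (cbox (0, 0) (1, 1)) (\<lambda>z. g (snd z))"
      by (rule continuous_on_compose2[OF g]) (auto intro!: continuous_intros simp: cbox_Pair_eq)
    then show "continuous_on (cbox (0, 0) (1, 1)) (\<lambda>(y, s). of_real (g s) * (character (-k) y * H (y + s *\<^sub>R v)))"
      unfolding split_beta by (intro continuous_intros continuous_on_compose2[OF cont]) auto
  qed
  also have "\<dots> = integral (cbox 0 1) (\<lambda>s. of_real (g s) * fourier_coeff (\<lambda>y. H (y + s *\<^sub>R v)) k)"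
    by (simp add: fourier_coeff_def)
  also have "\<dots> = integral (cbox 0 1) (\<lambda>s. (of_real (g s) * cis (2 * pi * (k \<bullet> v) * s)) * fourier_coeff H k)"
    by (simp add: fourier_coeff_shift[OF cont per k] character_def mult_ac)
  finally show ?thesis by simp
qed

lemma fourier_coeff_diff:
  assumes "continuous_on UNIV f" "continuous_on UNIV h"
  shows "fourier_coeff (\<lambda>x. f x - h x) k = fourier_coeff f k - fourier_coeff h k"
  unfolding fourier_coeff_def right_diff_distrib
  by (rule Henstock_Kurzweil_Integration.integral_diff)
    (auto intro!: integrable_continuous continuous_intros intro: continuous_on_subset[OF assms(1)] continuous_on_subset[OF assms(2)])

lemma fourier_coeff_const:
  "k \<in> lattice \<Longrightarrow> fourier_coeff (\<lambda>x. a) k = (if k = 0 then a else 0)"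
  unfolding fourier_coeff_def using integral_character[OF lattice_uminus, of k] by simp

text \<open>Here \<open>a\<close> and \<open>b\<close> stand for the moduli of the observable's
  coefficient and of the weight's transform. The Diophantine condition bounds the frequency below by
  \<open>T * (c * norm k powr (-\<tau>))\<close>; its \<open>m\<close>-th power is divided out of
  \<open>C2\<close>, and \<open>norm k ^ l\<close> out of \<open>C1\<close>.\<close>

lemma small_divisor_bound:
  fixes k \<omega> :: "real^'n"
  assumes k: "k \<in> lattice" "k \<noteq> 0" and dioph: "diophantine c \<tau> \<omega>" and c: "0 < c" and T: "0 < T"
    and a: "norm k ^ l * a \<le> C1" and b: "\<bar>2 * pi * (k \<bullet> (T *\<^sub>R \<omega>))\<bar> ^ m * b \<le> C2"
    and nonneg: "0 \<le> a" "0 \<le> b"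
  shows "b * a \<le> C1 * C2 / c ^ m * T powr (- real m) * norm k powr (- (real l - real m * \<tau>))"
proof -
  have nk: "0 < norm k" using k by simp
  have "c * norm k powr (-\<tau>) < \<bar>k \<bullet> \<omega>\<bar>"
    using dioph k unfolding diophantine_def lattice_def by blast
  then have "T * (c * norm k powr (-\<tau>)) \<le> 1 * (T * \<bar>k \<bullet> \<omega>\<bar>)" using T by simp
  also have "\<dots> \<le> 2 * pi * (T * \<bar>k \<bullet> \<omega>\<bar>)" using T pi_gt3 by (intro mult_right_mono) auto
  also have "\<dots> = \<bar>2 * pi * (k \<bullet> (T *\<^sub>R \<omega>))\<bar>" using T by (simp add: abs_mult)
  finally have "(T * (c * norm k powr (-\<tau>))) ^ m \<le> \<bar>2 * pi * (k \<bullet> (T *\<^sub>R \<omega>))\<bar> ^ m"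
    using T c by (intro power_mono) auto
  then have b': "(T * (c * norm k powr (-\<tau>))) ^ m * b \<le> C2"
    using b nonneg by (meson mult_right_mono order_trans)
  then have "(T * (c * norm k powr (-\<tau>))) ^ m * b * (norm k ^ l * a) \<le> C2 * C1"
    using a nonneg T c by (intro mult_mono b') (auto intro: order_trans[OF _ b'])
  moreover have "(T * (c * norm k powr (-\<tau>))) ^ m * norm k ^ l
      = T ^ m * c ^ m * norm k powr (real l - real m * \<tau>)"
  proof -
    have "(norm k powr (-\<tau>)) ^ m * norm k ^ l = norm k powr (real l - real m * \<tau>)"
      using nk by (simp add: powr_powr powr_add[symmetric] mult.commute flip: powr_realpow)
    then show ?thesis by (simp add: power_mult_distrib)
  qed
  ultimately have "T ^ m * c ^ m * norm k powr (real l - real m * \<tau>) * (b * a) \<le> C1 * C2"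
    by (metis (no_types, opaque_lifting) mult.assoc mult.commute mult.left_commute)
  moreover have "0 < T ^ m * c ^ m * norm k powr (real l - real m * \<tau>)" using T c nk by simp
  ultimately have "b * a \<le> C1 * C2 / (T ^ m * c ^ m * norm k powr (real l - real m * \<tau>))"
    by (simp add: pos_le_divide_eq mult.commute)
  also have "\<dots> = C1 * C2 / c ^ m * T powr (- real m) * norm k powr (- (real l - real m * \<tau>))"
    using T by (simp add: powr_minus powr_realpow divide_simps del: minus_diff_eq)
  finally show ?thesis .
qed

lemma weighted_average_converges:
  fixes H :: "real^'n \<Rightarrow> real"
  assumes Ck: "Ck l H" and per: "lattice_periodic H" and g: "weight_class (enat m) g"
    and c: "0 < c" and dioph: "diophantine c \<tau> \<omega>" and l: "real CARD('n) + real m * \<tau> < real l"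
  shows "\<exists>C>0. \<forall>T>0. \<forall>y. \<bar>integral {0..1} (\<lambda>s. g s * H (y + s *\<^sub>R (T *\<^sub>R \<omega>))) - integral (cbox 0 1) H\<bar>
    \<le> C * T powr (- real m)"
proof -
  define Hc where "Hc = (\<lambda>x. complex_of_real (H x))"
  have contH: "continuous_on UNIV H" by (rule Ck_continuous_on[OF Ck])
  have contHc: "continuous_on UNIV Hc" unfolding Hc_def by (intro continuous_intros contH)
  have perHc: "lattice_periodic Hc" using per by (simp add: Hc_def lattice_periodic_def)
  have contg: "continuous_on {0..1} g" by (rule weight_class_continuous_on[OF g])
  have g1: "integral {0..1} g = 1" using g by (simp add: weight_class_def)
  obtain C1 where C1: "0 < C1" "\<And>k. k \<in> lattice \<Longrightarrow> norm k ^ l * norm (fourier_coeff Hc k) \<le> C1"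
    using Ck_fourier_coeff_decay[OF Ck per] unfolding Hc_def by blast
  obtain C2 where C2: "0 < C2" "\<And>r. \<bar>r\<bar> ^ m * norm (integral {0..1} (\<lambda>s. of_real (g s) * cis (r * s))) \<le> C2"
    using weight_class_fourier_decay[OF g] by blast
  have "real CARD('n) < real l - real m * \<tau>" using l by simp
  from sum_lattice_powr_bounded[OF this] obtain S where
    S: "\<And>K::(real^'n) set. finite K \<Longrightarrow> K \<subseteq> lattice - {0} \<Longrightarrow> (\<Sum>k\<in>K. norm k powr (- (real l - real m * \<tau>))) \<le> S"
    by blast
  have S0: "0 \<le> S" using S[of "{}"] by simp
  \<comment> \<open>All ingredients are fixed before \<open>T\<close> and \<open>y\<close>, which
    gives uniformity; \<open>S\<close> is only known to be nonnegative, and \<open>S + 1\<close>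
    keeps \<open>C\<close> positive.\<close>
  define C where "C = C1 * C2 / c ^ m * (S + 1)"
  have C0: "0 < C" using C1 C2 c S0 by (simp add: C_def)
  have "\<bar>integral {0..1} (\<lambda>s. g s * H (y + s *\<^sub>R (T *\<^sub>R \<omega>))) - integral (cbox 0 1) H\<bar> \<le> C * T powr (- real m)"
    if T: "0 < T" for T y
  proof -
    define W where "W = (\<lambda>y. integral {0..1} (\<lambda>s. of_real (g s) * Hc (y + s *\<^sub>R (T *\<^sub>R \<omega>))))"
    \<comment> \<open>Subtracting the mean removes the zero frequency, where no small-divisor bound
      exists; the cancellation is exact because \<open>g\<close> has integral 1.\<close>
    define A where "A = (\<lambda>y. W y - fourier_coeff Hc 0)"
    have contW: "continuous_on UNIV W"
    proof -
      have "continuous_on (UNIV \<times> cbox 0 1) (\<lambda>z::(real^'n) \<times> real. g (snd z))"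
        by (rule continuous_on_compose2[OF contg]) (auto intro!: continuous_intros)
      then have "continuous_on (UNIV \<times> cbox 0 1) (\<lambda>(y, s). of_real (g s) * Hc (y + s *\<^sub>R (T *\<^sub>R \<omega>)))"
        unfolding split_beta by (intro continuous_intros continuous_on_compose2[OF contHc]) auto
      from integral_continuous_on_param[OF this] show ?thesis by (simp add: W_def)
    qed
    have contA: "continuous_on UNIV A" unfolding A_def by (intro continuous_intros contW)
    have "Hc (x + k + s *\<^sub>R (T *\<^sub>R \<omega>)) = Hc (x + s *\<^sub>R (T *\<^sub>R \<omega>))" if "k \<in> lattice" for x k s
      using perHc that by (metis lattice_periodic_def add.assoc add.commute)
    then have perA: "lattice_periodic A"
      unfolding A_def W_def lattice_periodic_def by simp
    have coeffA: "fourier_coeff A k =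
        integral {0..1} (\<lambda>s. of_real (g s) * cis (2 * pi * (k \<bullet> (T *\<^sub>R \<omega>)) * s)) * fourier_coeff Hc k
        - (if k = 0 then fourier_coeff Hc 0 else 0)" if "k \<in> lattice" for k
      using fourier_coeff_diff[OF contW continuous_on_const, of "fourier_coeff Hc 0" k]
        fourier_coeff_const[OF that, of "fourier_coeff Hc 0"]
        fourier_coeff_weighted_average[OF contHc perHc contg that, of "T *\<^sub>R \<omega>"]
      unfolding A_def W_def by simp
    have gc: "integral {0..1} (\<lambda>s. complex_of_real (g s)) = 1"
      using integral_of_real_integrable[OF integrable_continuous_interval[OF contg]] g1
      by simp
    have coeff0: "fourier_coeff A 0 = 0"
      using coeffA[OF lattice_zero] gc by (simp flip: one_complex.code)
    have "norm (A y) \<le> C * T powr (- real m)"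
    proof (rule norm_le_of_fourier_coeff_sums_le[OF contA perA])
      fix K :: "(real^'n) set" assume K: "finite K" "K \<subseteq> lattice"
      have "(\<Sum>k\<in>K. norm (fourier_coeff A k)) = (\<Sum>k\<in>K - {0}. norm (fourier_coeff A k))"
        using K coeff0 by (intro sum.mono_neutral_right) auto
      also have "\<dots> \<le> (\<Sum>k\<in>K - {0}. C1 * C2 / c ^ m * T powr (- real m) * norm k powr (- (real l - real m * \<tau>)))"
      proof (rule sum_mono)
        fix k assume "k \<in> K - {0}"
        then have k: "k \<in> lattice" "k \<noteq> 0" using K by auto
        show "norm (fourier_coeff A k) \<le> C1 * C2 / c ^ m * T powr (- real m) * norm k powr (- (real l - real m * \<tau>))"
          using small_divisor_bound[OF k dioph c T C1(2)[OF k(1)] C2(2)] k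
          by (simp add: coeffA norm_mult)
      qed
      also have "\<dots> = C1 * C2 / c ^ m * T powr (- real m) * (\<Sum>k\<in>K - {0}. norm k powr (- (real l - real m * \<tau>)))"
        by (rule sum_distrib_left[symmetric])
      also have "\<dots> \<le> C1 * C2 / c ^ m * T powr (- real m) * (S + 1)"
      proof (rule mult_left_mono)
        have "K - {0} \<subseteq> lattice - {0}" using K(2) by blast
        from S[OF _ this] K(1) show "(\<Sum>k\<in>K - {0}. norm k powr (- (real l - real m * \<tau>))) \<le> S + 1"
          by fastforce
      qed (use C1 C2 c in auto)
      also have "\<dots> = C * T powr (- real m)" by (simp add: C_def)
      finally show "(\<Sum>k\<in>K. norm (fourier_coeff A k)) \<le> C * T powr (- real m)" .
    qed
    moreover have "A y = of_real (integral {0..1} (\<lambda>s. g s * H (y + s *\<^sub>R (T *\<^sub>R \<omega>))) - integral (cbox 0 1) H)"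
    proof -
      have "(\<lambda>s. g s * H (y + s *\<^sub>R (T *\<^sub>R \<omega>))) integrable_on {0..1}"
        by (intro integrable_continuous_interval continuous_intros contg continuous_on_compose2[OF contH]) auto
      from integral_of_real_integrable[OF this]
      have "W y = of_real (integral {0..1} (\<lambda>s. g s * H (y + s *\<^sub>R (T *\<^sub>R \<omega>))))"
        by (simp add: W_def Hc_def)
      moreover have "H integrable_on cbox 0 1"
        by (rule integrable_continuous) (rule continuous_on_subset[OF contH], simp)
      from integral_of_real_integrable[OF this]
      have "fourier_coeff Hc 0 = of_real (integral (cbox 0 1) H)"
        by (simp add: fourier_coeff_def Hc_def)
      ultimately show ?thesis by (simp add: A_def)
    qed
    ultimately show ?thesis by (metis norm_of_real)
  qed
  with C0 show ?thesis by blast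
qed


section \<open>Reduction from the manifold to the torus\<close>

lemma lattice_periodic_lift_M:
  fixes \<Phi> :: "'m \<Rightarrow> real^'n"
  shows "lattice_periodic (lift_M \<Phi> h)"
proof -
  have "tmod (x + k) = tmod x" if k: "k \<in> lattice" for x k :: "real^'n"
  proof -
    have "frac (x $ i + k $ i) = frac (x $ i)" for i
    proof -
      obtain n :: int where "k $ i = of_int n" using k by (auto simp: lattice_def elim: Ints_cases)
      then show ?thesis by (simp add: frac_def)
    qed
    then show ?thesis by (simp add: tmod_def vec_eq_iff)
  qed
  then show ?thesis by (simp add: lattice_periodic_def lift_M_def)
qed

section \<open>The half-open cube and the pullback measure\<close>

lemma torus_cube_bounds: "box 0 1 \<subseteq> torus_cube" "torus_cube \<subseteq> cbox 0 (1::real^'n)"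
  by (auto simp: torus_cube_def mem_box_cart less_imp_le)

lemma negligible_cbox_diff_torus_cube: "negligible (cbox 0 (1::real^'n) - torus_cube)"
  by (rule negligible_subset[OF negligible_frontier_interval[of 0 "1::real^'n"]])
    (use torus_cube_bounds in blast)

lemma lebesgue_torus_cube: "(torus_cube :: (real^'n) set) \<in> sets lebesgue"
proof -
  have "(torus_cube :: (real^'n) set) = cbox 0 1 - (cbox 0 1 - torus_cube)"
    using torus_cube_bounds by blast
  then show ?thesis
    using negligible_imp_sets[OF negligible_cbox_diff_torus_cube] by (metis sets.Diff lmeasurable_cbox fmeasurableD)
qed

lemma tmod_torus_cube: "y \<in> torus_cube \<Longrightarrow> tmod y = y"
  by (simp add: tmod_def torus_cube_def vec_eq_iff frac_eq)

lemma lift_M_conjugacy: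
  assumes bij: "bij_betw \<Phi> UNIV torus_cube"
  shows "lift_M \<Phi> h (\<Phi> x) = h x"
proof -
  have "\<Phi> x \<in> torus_cube" "inj \<Phi>" using bij by (auto simp: bij_betw_def)
  then show ?thesis by (simp add: lift_M_def tmod_torus_cube)
qed

text \<open>A change of variables along the inverse of \<open>\<Phi>\<close>: on the half-open cube
  \<open>tmod\<close> is the identity, and passing to the closed cube adds a null set.\<close>

lemma integral_pullback_haar:
  fixes \<Phi> :: "'m \<Rightarrow> real^'n"
  assumes bij: "bij_betw \<Phi> UNIV torus_cube" and cont: "continuous_on UNIV (lift_M \<Phi> h)"
  shows "integral\<^sup>L (pullback_haar \<Phi>) h = integral (cbox 0 1) (lift_M \<Phi> h)"
proof -
  let ?L = "lebesgue_on torus_cube :: (real^'n) measure"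
  have sp: "space ?L = torus_cube" by (simp add: space_restrict_space)
  have inv: "\<Phi> (inv_into UNIV \<Phi> y) = y" if "y \<in> torus_cube" for y
    using bij that by (metis bij_betw_imp_surj_on f_inv_into_f)
  have meas_inv: "inv_into UNIV \<Phi> \<in> measurable ?L (vimage_algebra UNIV \<Phi> ?L)"
  \<comment> \<open>Measurability into the pulled-back sigma-algebra is tested after composing with
    \<open>\<Phi>\<close>, which gives the identity on the cube.\<close>
  proof (rule measurable_vimage_algebra2)
    have "(\<lambda>y. \<Phi> (inv_into UNIV \<Phi> y)) \<in> measurable ?L ?L \<longleftrightarrow> (\<lambda>y. y) \<in> measurable ?L ?L"
      by (rule measurable_cong) (simp add: sp inv)
    then show "(\<lambda>y. \<Phi> (inv_into UNIV \<Phi> y)) \<in> measurable ?L ?L" by simp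
  qed auto
  have meas_lift: "lift_M \<Phi> h \<in> borel_measurable ?L"
    by (intro continuous_imp_measurable_on_sets_lebesgue lebesgue_torus_cube continuous_on_subset[OF cont]) simp
  have "\<Phi> \<in> measurable (vimage_algebra UNIV \<Phi> ?L) ?L"
    using bij by (intro measurable_vimage_algebra1) (auto simp: sp bij_betw_def)
  from measurable_compose[OF this meas_lift]
  have meas_h: "h \<in> borel_measurable (vimage_algebra UNIV \<Phi> ?L)"
    by (simp add: lift_M_conjugacy[OF bij])
  have "lift_M \<Phi> h absolutely_integrable_on torus_cube"
    by (rule set_integrable_subset[OF absolutely_integrable_continuous[OF continuous_on_subset[OF cont]]
          lebesgue_torus_cube torus_cube_bounds(2)]) simp
  then have int: "integrable ?L (lift_M \<Phi> h)"
    by (simp add: integrable_restrict_space lebesgue_torus_cube set_integrable_def)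
  have "integral\<^sup>L (pullback_haar \<Phi>) h = integral\<^sup>L ?L (\<lambda>y. h (inv_into UNIV \<Phi> y))"
    unfolding pullback_haar_def by (rule integral_distr[OF meas_inv meas_h])
  also have "\<dots> = integral\<^sup>L ?L (lift_M \<Phi> h)"
    by (rule Bochner_Integration.integral_cong) (auto simp: sp lift_M_def tmod_torus_cube)
  also have "\<dots> = integral torus_cube (lift_M \<Phi> h)"
    by (rule lebesgue_integral_eq_integral[OF int lebesgue_torus_cube])
  also have "\<dots> = integral (cbox 0 1) (lift_M \<Phi> h)"
    using torus_cube_bounds
    by (intro integral_spike_set negligible_subset[OF negligible_cbox_diff_torus_cube]) auto
  finally show ?thesis .
qed

text \<open>The substitution \<open>t = T * s\<close> moves the time scale into the rotation vector,
  leaving an average over the unit interval.\<close>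

lemma WB_eq_weighted_average:
  fixes \<Phi> :: "'m \<Rightarrow> real^'n"
  assumes bij: "bij_betw \<Phi> UNIV torus_cube"
    and conj: "\<And>t x. \<Phi> (\<phi> t x) = tmod (\<Phi> x + t *\<^sub>R \<omega>)"
    and cont: "continuous_on UNIV (lift_M \<Phi> h)" and g: "continuous_on {0..1} g" and T: "0 < T"
  shows "WB g \<phi> h T x = integral {0..1} (\<lambda>s. g s * lift_M \<Phi> h (\<Phi> x + s *\<^sub>R (T *\<^sub>R \<omega>)))"
proof -
  \<comment> \<open>The conjugacy is read from right to left: \<open>tmod\<close> of the rotated
    point is \<open>\<Phi> (\<phi> t x)\<close>, and injectivity of \<open>\<Phi>\<close> returns
    \<open>\<phi> t x\<close>.\<close>
  have orbit: "h (\<phi> t x) = lift_M \<Phi> h (\<Phi> x + t *\<^sub>R \<omega>)" for t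
    using bij by (simp add: lift_M_def flip: conj) (simp add: bij_betw_def)
  define F where "F = (\<lambda>t. g (t / T) * h (\<phi> t x))"
  have "F integrable_on cbox 0 T"
    unfolding F_def orbit
    by (intro integrable_continuous continuous_intros continuous_on_compose2[OF cont]
        continuous_on_compose2[OF g, where f = "\<lambda>t. t / T"]) (use T in auto)
  from has_integral_affinity'[OF integrable_integral[OF this] T, of 0]
  have "((\<lambda>s. F (T * s)) has_integral (1 / T) * integral {0..T} F) {0..1}"
    using T by (simp add: divide_inverse mult.commute)
  moreover have "F (T * s) = g s * lift_M \<Phi> h (\<Phi> x + s *\<^sub>R (T *\<^sub>R \<omega>))" for s
    using T by (simp add: F_def orbit mult.commute)
  ultimately show ?thesis by (simp add: WB_def F_def integral_unique)
qed

lemma weight_class_infinity_imp: "weight_class \<infinity> g \<Longrightarrow> weight_class (enat m) g"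
  unfolding weight_class_def by (elim conjE exE, intro conjI exI) (assumption | simp)+

theorem mainTheorem3:
  fixes \<Phi> :: "'m \<Rightarrow> real^'n" and \<phi> :: "real \<Rightarrow> 'm \<Rightarrow> 'm"
    and \<omega> :: "real^'n" and c \<tau> :: real
  assumes bij: "bij_betw \<Phi> UNIV torus_cube"
    and conj: "\<And>t x. \<Phi> (\<phi> t x) = tmod (\<Phi> x + t *\<^sub>R \<omega>)"
    and c_pos: "c > 0"
    and tau: "\<tau> \<ge> real CARD('n) - 1"
    and dioph: "diophantine c \<tau> \<omega>"
  shows
    "(\<forall>h g. Cinf (lift_M \<Phi> h) \<and> weight_class \<infinity> g \<longrightarrow>
        (\<forall>m::nat. \<exists>cm>0. \<forall>T>0. \<forall>x.
           \<bar>WB g \<phi> h T x - integral\<^sup>L (pullback_haar \<Phi>) h\<bar> \<le> cm * T powr (- real m)))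
     \<and>
     (\<forall>(m::nat) g h (l::nat). weight_class (enat m) g \<and> Ck l (lift_M \<Phi> h)
        \<and> real l > real CARD('n) + real m * \<tau> \<longrightarrow>
        (\<exists>C>0. \<forall>T>0. \<forall>x.
           \<bar>WB g \<phi> h T x - integral\<^sup>L (pullback_haar \<Phi>) h\<bar> \<le> C * T powr (- real m)))"
proof -
  have finite_case: "\<exists>C>0. \<forall>T>0. \<forall>x.
      \<bar>WB g \<phi> h T x - integral\<^sup>L (pullback_haar \<Phi>) h\<bar> \<le> C * T powr (- real m)"
    if g: "weight_class (enat m) g" and Ck: "Ck l (lift_M \<Phi> h)"
      and l: "real l > real CARD('n) + real m * \<tau>" for m l :: nat and g h
  proof -
    note cont = Ck_continuous_on[OF Ck]
    obtain C where "C > 0" "\<And>T y. T > 0 \<Longrightarrow>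
        \<bar>integral {0..1} (\<lambda>s. g s * lift_M \<Phi> h (y + s *\<^sub>R (T *\<^sub>R \<omega>))) - integral (cbox 0 1) (lift_M \<Phi> h)\<bar>
        \<le> C * T powr (- real m)"
      using weighted_average_converges[OF Ck lattice_periodic_lift_M g c_pos dioph l] by blast
    then show ?thesis
      using WB_eq_weighted_average[OF bij conj cont weight_class_continuous_on[OF g]]
        integral_pullback_haar[OF bij cont] by metis
  qed
  moreover have "\<exists>cm>0. \<forall>T>0. \<forall>x.
      \<bar>WB g \<phi> h T x - integral\<^sup>L (pullback_haar \<Phi>) h\<bar> \<le> cm * T powr (- real m)"
    if "Cinf (lift_M \<Phi> h)" "weight_class \<infinity> g" for h g and m :: nat
  proof -
    \<comment> \<open>A smooth observable satisfies \<open>Ck l\<close> for every \<open>l\<close>,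
      so for each \<open>m\<close> some \<open>l\<close> above the threshold is available.\<close>
    obtain l :: nat where "real CARD('n) + real m * \<tau> < real l" using reals_Archimedean2 by blast
    with that show ?thesis
      by (intro finite_case[of m g l h]) (auto simp: Cinf_def weight_class_infinity_imp)
  qed
  ultimately show ?thesis by blast
qed


end
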